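(* Let $F\colon\mathbb{R}^n\rightrightarrows\mathbb{R}^p$ be a set-valued mapping with convex graph, and let $\Theta$ be a convex subset of $\mathbb{R}^p$. Suppose that there exists $(a,b)\in\mathbb{R}^n\times\mathbb{R}^p$ satisfying $$(a,b)\in\mathrm{ri}(\mathrm{gph}(F))\quad\text{and}\quad b\in\mathrm{ri}(\Theta).$$ Then for any $\bar{x}\in F^{-1}(\Theta)$ and $\bar{y}\in F(\bar{x})\cap\Theta$ we have $$N(\bar{x};F^{-1}(\Theta))=D^*F(\bar{x},\bar{y})\big(N(\bar{y};\Theta)\big).$$
   Context: A set-valued mapping $F\colon\mathbb{R}^n\rightrightarrows\mathbb{R}^p$ assigns to each $x$ a set $F(x)\subset\mathbb{R}^p$ (possibly empty); $\mathrm{gph}(F):=\{(x,y) : y\in F(x)\}$. The preimage of $\Theta$ is $F^{-1}(\Theta):=\{x\in\mathbb{R}^n : F(x)\cap\Theta\neq\emptyset\}$. For a convex set $\Omega$ and $\bar{x}\in\Omega$, the normal cone is $N(\bar{x};\Omega):=\{v : \langle v,x-\bar{x}\rangle\le 0\text{ for all }x\in\Omega\}$. The coderivative of $F$ at $(\bar{x},\bar{y})\in\mathrm{gph}(F)$ is $D^*F(\bar{x},\bar{y})(v):=\{u\in\mathbb{R}^n : (u,-v)\in N((\bar{x},\bar{y});\mathrm{gph}(F))\}$, $v\in\mathbb{R}^p$; for a set $V\subset\mathbb{R}^p$, $D^*F(\bar{x},\bar{y})(V):=\bigcup_{v\in V}D^*F(\bar{x},\bar{y})(v)$. The relative interior $\mathrm{ri}(\Omega)$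 of a convex set $\Omega$ is the set of $x\in\Omega$ for which there is $\gamma>0$ with $\mathbb{B}(x;\gamma)\cap\mathrm{aff}(\Omega)\subset\Omega$ (closed ball, affine hull). *)

theory Defs
  imports "HOL-Analysis.Analysis"
begin

text \<open>
  A set-valued mapping is a function \<open>F :: 'a \<Rightarrow> 'b set\<close>; its values may be empty.
\<close>

definition gph :: "('a \<Rightarrow> 'b set) \<Rightarrow> ('a \<times> 'b) set" where
  "gph F = {(x, y). y \<in> F x}"

definition sv_preimage :: "('a \<Rightarrow> 'b set) \<Rightarrow> 'b set \<Rightarrow> 'a set" where
  "sv_preimage F \<Theta> = {x. F x \<inter> \<Theta> \<noteq> {}}"

text \<open>
  The normal cone of convex analysis. It is only meaningful for convex \<open>\<Omega>\<close> and
  \<open>xbar \<in> \<Omega>\<close>; outside that range the formula is kept without any convention.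
\<close>

definition normal_cone :: "'a::real_inner \<Rightarrow> 'a set \<Rightarrow> 'a set" where
  "normal_cone xbar \<Omega> = {v. \<forall>x\<in>\<Omega>. v \<bullet> (x - xbar) \<le> 0}"

text \<open>
  The coderivative at \<open>(xbar, ybar) \<in> gph F\<close>. The inner product on the product space is
  \<open>(u, v) \<bullet> (x, y) = u \<bullet> x + v \<bullet> y\<close>.
\<close>

definition coderivative ::
  "('a::real_inner \<Rightarrow> 'b::real_inner set) \<Rightarrow> 'a \<times> 'b \<Rightarrow> 'b \<Rightarrow> 'a set" where
  "coderivative F z v = {u. (u, - v) \<in> normal_cone z (gph F)}"

definition coderivative_set ::
  "('a::real_inner \<Rightarrow> 'b::real_inner set) \<Rightarrow> 'a \<times> 'b \<Rightarrow> 'b set \<Rightarrow> 'a set" where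
  "coderivative_set F z V = (\<Union>v\<in>V. coderivative F z v)"

end

theory Submission
  imports Defs
begin

text \<open>
  The preimage \<open>sv_preimage F \<Theta>\<close> is the projection of \<open>gph F \<inter> (UNIV \<times> \<Theta>)\<close> onto the first factor, and
  a functional \<open>u\<close> composed with this projection is \<open>(u, 0)\<close>. Hence \<open>u\<close> is normal to the preimage
  at \<open>xbar\<close> exactly if \<open>(u, 0)\<close> is normal to the intersection at \<open>(xbar, ybar)\<close>. Since normals to
  \<open>UNIV \<times> \<Theta>\<close> have the form \<open>(0, v)\<close> with \<open>v\<close> normal to \<open>\<Theta>\<close>, a splitting
  \<open>(u, 0) = (u, - v) + (0, v)\<close> into a normal to the graph and a normal to \<open>UNIV \<times> \<Theta>\<close> says precisely
  that \<open>u\<close> lies in the coderivative image of \<open>v\<close>. So the theorem is the sum rule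
  \<open>N(x; A \<inter> B) = N(x; A) + N(x; B)\<close> for these two sets; the point \<open>(a, b)\<close> lies in both
  relative interiors, which is the qualification that the sum rule asks for.

  The sum rule (\<open>normal_cone_Int\<close>) is a separation argument. A normal \<open>v\<close> to \<open>A \<inter> B\<close> makes the origin a
  relative boundary point of the convex set of all \<open>(y - z, r)\<close> with \<open>y \<in> A\<close>, \<open>z \<in> B\<close> and
  \<open>r \<le> v \<bullet> (y - x)\<close>. If a supporting hyperplane at the origin is not vertical, its slope is the
  wanted splitting of \<open>v\<close>. A vertical one would give a functional separating \<open>A\<close> from \<open>B\<close>; such a
  functional is constant on \<open>A \<union> B\<close> because the relative interiors meet
  (\<open>inner_constant_if_minimal_at_rel_interior\<close>), so the hyperplane would contain the whole convex set,
  which proper support forbids.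
\<close>

text \<open>
  From a relative interior point one can move a little beyond it, away from any other point of the
  set; if the functional were larger at that other point, this move would take it below its minimum.
\<close>

lemma inner_constant_if_minimal_at_rel_interior:
  fixes S :: "'a::euclidean_space set"
  assumes "convex S" "c \<in> rel_interior S" "y \<in> S"
    and min: "\<And>s. s \<in> S \<Longrightarrow> p \<bullet> c \<le> p \<bullet> s"
  shows "p \<bullet> y = p \<bullet> c"
proof -
  obtain e where e: "e > 1" "(1 - e) *\<^sub>R y + e *\<^sub>R c \<in> S"
    using convex_rel_interior_if2[OF assms(1,2), rule_format, OF hull_inc[OF assms(3)]] by metis
  have "p \<bullet> c \<le> (1 - e) * (p \<bullet> y) + e * (p \<bullet> c)"
    using min[OF e(2)] by (simp add: inner_add_right)
  then have "(e - 1) * (p \<bullet> y - p \<bullet> c) \<le> 0"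
    by (simp add: algebra_simps)
  then have "p \<bullet> y \<le> p \<bullet> c"
    using e(1) by (simp add: mult_le_0_iff)
  with min[OF assms(3)] show ?thesis by simp
qed

text \<open>
  The multiplier form of the sum rule: with \<open>x\<close> as one of the two arguments, the inequality yields
  that \<open>v - p\<close> is normal to \<open>A\<close> and that \<open>p\<close> is normal to \<open>B\<close>. It is the convex duality statement for
  maximising \<open>v \<bullet> (y - x)\<close> over \<open>y \<in> A\<close>, \<open>z \<in> B\<close> subject to \<open>y - z = 0\<close>, with \<open>p\<close> as Lagrange
  multiplier.
\<close>

lemma normal_cone_Int_multiplier:
  fixes A B :: "'a::euclidean_space set"
  assumes "convex A" "convex B" "x \<in> A" "x \<in> B"
    and c: "c \<in> rel_interior A" "c \<in> rel_interior B"
    and v: "v \<in> normal_cone x (A \<inter> B)"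
  obtains p where "\<And>y z. y \<in> A \<Longrightarrow> z \<in> B \<Longrightarrow> v \<bullet> (y - x) \<le> p \<bullet> (y - z)"
proof -
  define K where "K = {(y - z, r) |y z r. y \<in> A \<and> z \<in> B \<and> r \<le> v \<bullet> (y - x)}"
  have KI: "(y - z, r) \<in> K" if "y \<in> A" "z \<in> B" "r \<le> v \<bullet> (y - x)" for y z r
    using that unfolding K_def by blast
  have fibre: "r \<le> 0" if K: "(0, r) \<in> K" for r
  proof -
    obtain y where "y \<in> A" "y \<in> B" "r \<le> v \<bullet> (y - x)"
      using K unfolding K_def by auto
    with v show ?thesis unfolding normal_cone_def by force
  qed
  have "convex K"
  proof (rule convexI)
    fix k l and s t :: real
    assume k: "k \<in> K" and l: "l \<in> K" and st: "0 \<le> s" "0 \<le> t" "s + t = 1"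
    obtain y z r where k': "k = (y - z, r)" "y \<in> A" "z \<in> B" "r \<le> v \<bullet> (y - x)"
      using k unfolding K_def by blast
    obtain y' z' r' where l': "l = (y' - z', r')" "y' \<in> A" "z' \<in> B" "r' \<le> v \<bullet> (y' - x)"
      using l unfolding K_def by blast
    have eq: "s *\<^sub>R k + t *\<^sub>R l = ((s *\<^sub>R y + t *\<^sub>R y') - (s *\<^sub>R z + t *\<^sub>R z'), s * r + t * r')"
      by (simp add: k' l' algebra_simps)
    have "s *\<^sub>R (y - x) + t *\<^sub>R (y' - x) = s *\<^sub>R y + t *\<^sub>R y' - (s + t) *\<^sub>R x"
      by (simp add: algebra_simps)
    then have "s *\<^sub>R (y - x) + t *\<^sub>R (y' - x) = s *\<^sub>R y + t *\<^sub>R y' - x"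
      by (simp add: st)
    then have "v \<bullet> (s *\<^sub>R y + t *\<^sub>R y' - x) = s * (v \<bullet> (y - x)) + t * (v \<bullet> (y' - x))"
      by (metis inner_add_right inner_scaleR_right)
    moreover have "s * r + t * r' \<le> s * (v \<bullet> (y - x)) + t * (v \<bullet> (y' - x))"
      using k' l' st by (intro add_mono mult_left_mono) auto
    ultimately show "s *\<^sub>R k + t *\<^sub>R l \<in> K"
      unfolding eq using k' l' st assms(1,2) by (intro KI) (auto simp: convexD)
  qed
  have zero: "(0, 0) \<in> K"
    using KI[OF assms(3,4), of 0] by simp
  have "(0, 0) \<notin> rel_interior K"
  proof
    assume ri: "(0, 0) \<in> rel_interior K"
    have "(0, - 1) \<in> affine hull K"
      using KI[OF assms(3,4), of "- 1"] by (simp add: hull_inc)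
    \<comment> \<open>Moving from \<open>(0, - 1)\<close> beyond the origin would enter the part of the fibre with \<open>r > 0\<close>.\<close>
    from convex_rel_interior_if2[OF \<open>convex K\<close> ri, rule_format, OF this]
    obtain e where "e > 1" "(1 - e) *\<^sub>R (0, - 1) + e *\<^sub>R (0, 0) \<in> K"
      by metis
    then show False using fibre[of "e - 1"] by simp
  qed
  then obtain w where w: "\<And>k. k \<in> K \<Longrightarrow> w \<bullet> (0, 0) \<le> w \<bullet> k"
    and w_strict: "\<And>k. k \<in> rel_interior K \<Longrightarrow> w \<bullet> (0, 0) < w \<bullet> k"
    using supporting_hyperplane_rel_boundary[OF \<open>convex K\<close> zero] by metis
  obtain p q where pq: "w = (p, q)" by (cases w)
  have sep: "0 \<le> p \<bullet> (y - z) + q * r" if "y \<in> A" "z \<in> B" "r \<le> v \<bullet> (y - x)" for y z r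
    using w[OF KI[OF that]] by (simp add: pq)
  have "q \<le> 0"
    using sep[OF assms(3,4), of "- 1"] by simp
  moreover have "q \<noteq> 0"
  proof
    assume "q = 0"
    then have pos: "p \<bullet> z \<le> p \<bullet> y" if "y \<in> A" "z \<in> B" for y z
      using sep[OF that, of "v \<bullet> (y - x)"] by (simp add: inner_diff_right)
    have cAB: "c \<in> A" "c \<in> B"
      using c rel_interior_subset by blast+
    have "p \<bullet> y = p \<bullet> c" if "y \<in> A" for y
      using inner_constant_if_minimal_at_rel_interior[OF assms(1) c(1) that] pos cAB by blast
    moreover have "p \<bullet> z = p \<bullet> c" if "z \<in> B" for z
      using inner_constant_if_minimal_at_rel_interior[OF assms(2) c(2) that, of "- p"] pos cAB
      by auto
    ultimately have "w \<bullet> k = 0" if "k \<in> K" for k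
      using that \<open>q = 0\<close> unfolding K_def by (auto simp: pq inner_diff_right)
    moreover obtain k where "k \<in> rel_interior K"
      using rel_interior_eq_empty[OF \<open>convex K\<close>] zero by blast
    moreover from this have "k \<in> K"
      using rel_interior_subset by blast
    ultimately have "w \<bullet> k = 0" "w \<bullet> (0, 0) < w \<bullet> k"
      using w_strict by blast+
    then show False
      by (simp add: pq)
  qed
  ultimately have "q < 0" by simp
  \<comment> \<open>Normalise the hyperplane so that its last coefficient becomes \<open>- 1\<close>.\<close>
  have "v \<bullet> (y - x) \<le> (p /\<^sub>R (- q)) \<bullet> (y - z)" if "y \<in> A" "z \<in> B" for y z
  proof -
    have "(- q) * (v \<bullet> (y - x)) \<le> p \<bullet> (y - z)"
      using sep[OF that order_refl] by simp
    then have "v \<bullet> (y - x) \<le> (p \<bullet> (y - z)) / (- q)"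
      using \<open>q < 0\<close> by (subst pos_le_divide_eq) (simp_all add: mult.commute)
    also have "\<dots> = (p /\<^sub>R (- q)) \<bullet> (y - z)"
      by (simp add: divide_inverse mult.commute)
    finally show ?thesis .
  qed
  then show thesis by (rule that)
qed

theorem normal_cone_Int:
  fixes A B :: "'a::euclidean_space set"
  assumes "convex A" "convex B" "x \<in> A" "x \<in> B"
    and "rel_interior A \<inter> rel_interior B \<noteq> {}"
  shows "normal_cone x (A \<inter> B) = {v + w |v w. v \<in> normal_cone x A \<and> w \<in> normal_cone x B}"
proof (intro equalityI subsetI)
  fix v assume v: "v \<in> normal_cone x (A \<inter> B)"
  obtain c where c: "c \<in> rel_interior A" "c \<in> rel_interior B"
    using assms(5) by blast
  obtain p where p: "\<And>y z. y \<in> A \<Longrightarrow> z \<in> B \<Longrightarrow> v \<bullet> (y - x) \<le> p \<bullet> (y - z)"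
    using normal_cone_Int_multiplier[OF assms(1-4) c v] by metis
  have "v - p \<in> normal_cone x A"
    using p[OF _ assms(4)] by (auto simp: normal_cone_def inner_diff_left)
  moreover have "p \<in> normal_cone x B"
    using p[OF assms(3)] by (auto simp: normal_cone_def inner_diff_right)
  ultimately show "v \<in> {v + w |v w. v \<in> normal_cone x A \<and> w \<in> normal_cone x B}"
    by (intro CollectI exI[of _ "v - p"] exI[of _ p]) simp
next
  fix u assume "u \<in> {v + w |v w. v \<in> normal_cone x A \<and> w \<in> normal_cone x B}"
  then show "u \<in> normal_cone x (A \<inter> B)"
    by (auto simp: normal_cone_def inner_add_left intro!: add_nonpos_nonpos)
qed

text \<open>A functional bounded above on the whole first factor has vanishing first component.\<close>

lemma normal_cone_UNIV_Times:
  fixes x :: "'a::real_inner" and y :: "'b::real_inner"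
  assumes "y \<in> T"
  shows "normal_cone (x, y) (UNIV \<times> T) = {0} \<times> normal_cone y T"
proof (intro equalityI subsetI)
  fix w assume w: "w \<in> normal_cone (x, y) (UNIV \<times> T)"
  obtain u v where uv: "w = (u, v)" by (cases w)
  have le: "u \<bullet> (x' - x) + v \<bullet> (y' - y) \<le> 0" if "y' \<in> T" for x' y'
    using w that by (auto simp: normal_cone_def uv)
  have "u \<bullet> u \<le> 0"
    using le[OF assms, of "x + u"] by simp
  then have "u = 0"
    using inner_gt_zero_iff[of u] by (meson not_le)
  then show "w \<in> {0} \<times> normal_cone y T"
    using le by (auto simp: uv normal_cone_def)
qed (auto simp: normal_cone_def)

lemma normal_cone_sv_preimage_iff:
  "u \<in> normal_cone x (sv_preimage F T) \<longleftrightarrow> (u, 0) \<in> normal_cone (x, y) (gph F \<inter> UNIV \<times> T)"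
proof -
  have "sv_preimage F T = fst ` (gph F \<inter> UNIV \<times> T)"
    by (force simp: sv_preimage_def gph_def)
  moreover have "(u, 0) \<bullet> (k - (x, y)) = u \<bullet> (fst k - x)" for k
    by (cases k) simp
  ultimately show ?thesis by (simp add: normal_cone_def)
qed

theorem theorem10p1:
  fixes F :: "real ^ 'n \<Rightarrow> (real ^ 'p) set"
    and \<Theta> :: "(real ^ 'p) set"
  assumes "convex (gph F)"
    and "convex \<Theta>"
    and "\<exists>a b. (a, b) \<in> rel_interior (gph F) \<and> b \<in> rel_interior \<Theta>"
  shows "\<forall>xbar \<in> sv_preimage F \<Theta>. \<forall>ybar \<in> F xbar \<inter> \<Theta>.
           normal_cone xbar (sv_preimage F \<Theta>)
             = coderivative_set F (xbar, ybar) (normal_cone ybar \<Theta>)"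
proof (intro ballI set_eqI)
  fix xbar ybar u
  assume y: "ybar \<in> F xbar \<inter> \<Theta>"
  define B :: "((real ^ 'n) \<times> (real ^ 'p)) set" where "B = UNIV \<times> \<Theta>"
  have mem: "(xbar, ybar) \<in> gph F" "(xbar, ybar) \<in> B"
    using y by (auto simp: gph_def B_def)
  have "convex B"
    using assms(2) by (simp add: B_def convex_Times)
  have ri: "rel_interior (gph F) \<inter> rel_interior B \<noteq> {}"
    using assms(2,3) by (auto simp: B_def rel_interior_Times)
  have NB: "normal_cone (xbar, ybar) B = {0} \<times> normal_cone ybar \<Theta>"
    using y by (simp add: B_def normal_cone_UNIV_Times)
  have "u \<in> normal_cone xbar (sv_preimage F \<Theta>)
      \<longleftrightarrow> (u, 0) \<in> normal_cone (xbar, ybar) (gph F \<inter> B)"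
    unfolding B_def by (rule normal_cone_sv_preimage_iff)
  also have "\<dots> \<longleftrightarrow> (\<exists>v \<in> normal_cone ybar \<Theta>. (u, - v) \<in> normal_cone (xbar, ybar) (gph F))"
    (is "?L \<longleftrightarrow> ?R")
  proof
    assume ?L
    then obtain p v where "(u, 0) = p + (0, v)" "v \<in> normal_cone ybar \<Theta>"
        "p \<in> normal_cone (xbar, ybar) (gph F)"
      unfolding normal_cone_Int[OF assms(1) \<open>convex B\<close> mem ri] NB by blast
    moreover from this(1) have "p = (u, - v)"
      by (cases p) (simp add: eq_neg_iff_add_eq_0)
    ultimately show ?R by blast
  next
    assume ?R
    then obtain v where "v \<in> normal_cone ybar \<Theta>"
        "(u, - v) \<in> normal_cone (xbar, ybar) (gph F)"
      by blast
    moreover have "(u, 0) = (u, - v) + (0, v)"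
      by simp
    ultimately show ?L
      unfolding normal_cone_Int[OF assms(1) \<open>convex B\<close> mem ri] NB by blast
  qed
  also have "\<dots> \<longleftrightarrow> u \<in> coderivative_set F (xbar, ybar) (normal_cone ybar \<Theta>)"
    by (auto simp: coderivative_set_def coderivative_def)
  finally show "u \<in> normal_cone xbar (sv_preimage F \<Theta>)
      \<longleftrightarrow> u \<in> coderivative_set F (xbar, ybar) (normal_cone ybar \<Theta>)" .
qed

end
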